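(* Let $m\ge 0$ be an integer, let $c_0,\dots,c_m\in\mathbb{C}$, and let $(u_i)_{i\ge 0}$ be a sequence of complex numbers satisfying $u_i=F(u_{i-1})$ for all $i\ge 1$, where $F(x)=\sum_{j=0}^{m}c_jx^j$. Suppose that the polynomial equation $\sum_{j=0}^{m}c_jd^j=d$ has a root $d\in\mathbb{C}$ such that $$\left|\sum_{j=1}^{m}jc_jd^{j-1}\right|\neq 0\quad\text{and}\quad\left(\left|\sum_{j=1}^{m}jc_jd^{j-1}\right|\neq 1\ \text{ or }\ \arg\Big(\sum_{j=1}^{m}jc_jd^{j-1}\Big)\notin\mathbb{Q}\right).$$ Then the solution of the recurrence is given by $$u_i=d+\sum_{l=1}^{\infty}\sum_{j=1}^{l}v'^{\,1}_{j}\,(c'_1)^{ij}\,P'^{-1}_{jl}\,(u_0-d)^l ,$$ where the quantities are defined as follows. (i) $c'_0=0$ and $c'_l=\sum_{j=l}^{m}c_j\binom{j}{l}d^{j-l}$ for $1\le l\le m$. (ii) For integers $a,b\ge 0$, $$T'_{ab}=\sum_{\substack{k_0+\dots+k_m=a\\ \sum_{l=0}^m l k_l=b}}\frac{a!}{\prod_{s=0}^{m}k_s!}\prod_{t=0}^{m}(c'_t)^{k_t},$$ the sum being over nonnegative integers $k_0,\dots,k_m$. (iii) With $\lambda_a=T'_{aa}$, the numbers $v'^{\,b}_a$ ($a,b\ge 0$) are $v'^{\,b}_a=0$ for $b>a$, $v'^{\,a}_a=1$, and for $b<a$ $$v'^{\,b}_a=\sum_{p=0}^{a-b-1}\ \sum_{b=l_0<l_1<\dots<l_p<l_{p+1}=a}(-1)^{p+1}\prod_{j=0}^{p}\frac{T'_{l_j,l_{j+1}}}{T'_{l_j,l_j}-\lambda_a}.$$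 (iv) The numbers $P'^{-1}_{ba}$ ($a,b\ge0$) are $P'^{-1}_{ba}=0$ for $b>a$, $P'^{-1}_{aa}=1$, and for $b<a$ $$P'^{-1}_{ba}=\sum_{p=0}^{a-b-1}\ \sum_{b=l_0<l_1<\dots<l_p<l_{p+1}=a}(-1)^{p+1}\prod_{j=0}^{p}\frac{v'^{\,l_j}_{l_{j+1}}}{v'^{\,l_j}_{l_j}}.$$
   Context: Conventions: $0^0=1$; an empty sum is $0$; $\arg$ denotes the argument of a complex number. Superscripts on $v'$ are indices (components), not powers: $v'^{\,b}_a$ is the $b$-th component of a vector indexed by $a$. $P'^{-1}_{ba}$ is the $(b,a)$ entry of an infinite matrix with rows and columns indexed from $0$. In the inner sums, $l_0=b$ and $l_{p+1}=a$ are fixed and the sum is over integers $l_1,\dots,l_p$ with the indicated strict inequalities.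
   Formalization: The argument is measured in full turns (arg/(2π) not rational) instead of radians; in radians a derivative such as −1 (arg π) would be allowed, yet it is a root of unity and makes denominators T'_{ll} − λ_a vanish, leaving v' undefined. *)

theory Defs
  imports "HOL-Analysis.Analysis"
begin

text \<open>
  Throughout, only the values \<open>c 0, \<dots>, c m\<close> of the coefficient function \<open>c\<close> are used, and
  \<open>d\<close> is the chosen fixed point of \<open>F x = (\<Sum>j\<le>m. c j * x ^ j)\<close>.  All powers have natural
  exponents, so \<open>0 ^ 0 = 1\<close>.
\<close>

text \<open>The coefficients $c'_l$ of \<open>F (d + x) - d\<close>; for \<open>l > m\<close> the value is the empty sum.\<close>

definition shifted_coeff :: "nat \<Rightarrow> (nat \<Rightarrow> complex) \<Rightarrow> complex \<Rightarrow> nat \<Rightarrow> complex" where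
  "shifted_coeff m c d l =
     (if l = 0 then 0 else (\<Sum>j=l..m. c j * of_nat (j choose l) * d ^ (j - l)))"

text \<open>
  The index set of the multinomial sum: tuples $(k_0,\dots,k_m)$ are extensional functions on
  \<open>{..m}\<close>, so that each tuple is represented by exactly one function.
\<close>

definition exponent_tuples :: "nat \<Rightarrow> nat \<Rightarrow> nat \<Rightarrow> (nat \<Rightarrow> nat) set" where
  "exponent_tuples m a b =
     {k \<in> {..m} \<rightarrow>\<^sub>E UNIV. (\<Sum>l\<le>m. k l) = a \<and> (\<Sum>l\<le>m. l * k l) = b}"

lemma finite_exponent_tuples: "finite (exponent_tuples m a b)"
proof (rule finite_subset)
  show "exponent_tuples m a b \<subseteq> {..m} \<rightarrow>\<^sub>E {..a}"
  proof
    fix k assume k: "k \<in> exponent_tuples m a b"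
    have "k i \<le> a" if "i \<le> m" for i
    proof -
      have "k i \<le> (\<Sum>l\<le>m. k l)"
        by (rule member_le_sum) (use that in auto)
      with k show ?thesis
        by (simp add: exponent_tuples_def)
    qed
    with k show "k \<in> {..m} \<rightarrow>\<^sub>E {..a}"
      by (simp add: exponent_tuples_def PiE_iff)
  qed
  show "finite ({..m} \<rightarrow>\<^sub>E {..a})"
    by (rule finite_PiE) simp_all
qed

text \<open>\<open>transfer_entry m c d a b\<close> is $T'_{ab}$.\<close>

definition transfer_entry ::
    "nat \<Rightarrow> (nat \<Rightarrow> complex) \<Rightarrow> complex \<Rightarrow> nat \<Rightarrow> nat \<Rightarrow> complex" where
  "transfer_entry m c d a b =
     (\<Sum>k \<in> exponent_tuples m a b.
        (fact a / (\<Prod>s\<le>m. fact (k s))) * (\<Prod>t\<le>m. shifted_coeff m c d t ^ k t))"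

text \<open>
  The chains \<open>b = l 0 < l 1 < \<dots> < l p < l (p + 1) = a\<close>, again as extensional functions; the
  codomain \<open>{b..a}\<close> is no restriction, since it is implied by monotonicity.
\<close>

definition chains :: "nat \<Rightarrow> nat \<Rightarrow> nat \<Rightarrow> (nat \<Rightarrow> nat) set" where
  "chains p b a =
     {l \<in> {..Suc p} \<rightarrow>\<^sub>E {b..a}. l 0 = b \<and> l (Suc p) = a \<and> (\<forall>j\<le>p. l j < l (Suc j))}"

lemma finite_chains: "finite (chains p b a)"
  unfolding chains_def
  by (rule finite_subset[of _ "{..Suc p} \<rightarrow>\<^sub>E {b..a}"], blast, rule finite_PiE, simp_all)

text \<open>
  \<open>eigvec_entry m c d b a\<close> is $v'^{\,b}_a$, the component \<open>b\<close> of the eigenvector of the matrix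
  $T'$ for the eigenvalue $\lambda_a = T'_{aa}$: the upper index comes first.
\<close>

definition eigvec_entry ::
    "nat \<Rightarrow> (nat \<Rightarrow> complex) \<Rightarrow> complex \<Rightarrow> nat \<Rightarrow> nat \<Rightarrow> complex" where
  "eigvec_entry m c d b a =
     (if b > a then 0 else if b = a then 1 else
       (\<Sum>p = 0..a - b - 1. \<Sum>l \<in> chains p b a.
          (-1) ^ (p + 1) *
          (\<Prod>j = 0..p. transfer_entry m c d (l j) (l (j + 1)) /
             (transfer_entry m c d (l j) (l j) - transfer_entry m c d a a))))"

text \<open>\<open>inv_eigvec_entry m c d b a\<close> is $P'^{-1}_{ba}$.\<close>

definition inv_eigvec_entry ::
    "nat \<Rightarrow> (nat \<Rightarrow> complex) \<Rightarrow> complex \<Rightarrow> nat \<Rightarrow> nat \<Rightarrow> complex" where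
  "inv_eigvec_entry m c d b a =
     (if b > a then 0 else if b = a then 1 else
       (\<Sum>p = 0..a - b - 1. \<Sum>l \<in> chains p b a.
          (-1) ^ (p + 1) *
          (\<Prod>j = 0..p. eigvec_entry m c d (l j) (l (j + 1)) / eigvec_entry m c d (l j) (l j))))"

text \<open>
  The argument of a complex number measured in full turns, so that
  \<open>z = of_real (norm z) * cis (2 * pi * arg_turns z)\<close>.  In this normalisation (and not in radians)
  a rational argument of a number of modulus 1 means that it is a root of unity, which is what
  makes the denominators $T'_{l_j l_j} - \lambda_a$ vanish.
\<close>

definition arg_turns :: "complex \<Rightarrow> real" where
  "arg_turns z = Arg z / (2 * pi)"

end

theory Submission
  imports Defs
begin

text \<open>
  In the coordinate \<open>z = x - d\<close> the recurrence becomes iteration of \<open>G z = F (d + z) - d\<close>, a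
  polynomial with \<open>G 0 = 0\<close>, and row \<open>a\<close> of the upper triangular matrix $T'$ lists the
  coefficients of \<open>G z ^ a\<close>. Its diagonal entries are the powers of the multiplier $c'_1$, which
  are pairwise distinct because $c'_1$ is neither zero nor a root of unity. Unrolling the chain sums
  yields $T' v'_a = \lambda_a v'_a$ and $P' P'^{-1} = 1$, so row \<open>a\<close> of
  $P' \Lambda^i P'^{-1} = T'^i$ lists the coefficients of the \<open>a\<close>-th power of the \<open>i\<close>-th iterate
  of \<open>G\<close>. Row 1 is the claim; the series terminates, since iterates of \<open>G\<close> are polynomials.
\<close>

section \<open>Sums over chains\<close>

text \<open>The weight \<open>w\<close> stays abstract because $v'$ and $P'^{-1}$ are both built
  from such sums, with different weights. For fixed \<open>p\<close> these are the entries of the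
  power \<open>p + 1\<close> of the strictly upper triangular part of \<open>w\<close>.\<close>

definition chain_sum :: "(nat \<Rightarrow> nat \<Rightarrow> 'a::comm_ring_1) \<Rightarrow> nat \<Rightarrow> nat \<Rightarrow> nat \<Rightarrow> 'a" where
  "chain_sum w p b a = (\<Sum>l \<in> chains p b a. \<Prod>j = 0..p. w (l j) (l (j + 1)))"

lemma chains_0:
  assumes "b < a"
  shows "chains 0 b a = {\<lambda>i\<in>{..Suc 0}. if i = 0 then b else a}"
proof (intro equalityI subsetI)
  fix l assume "l \<in> chains 0 b a"
  then have "l i = (\<lambda>i\<in>{..Suc 0}. if i = 0 then b else a) i" for i
    by (cases "i \<le> Suc 0") (auto simp: chains_def le_Suc_eq PiE_def extensional_def)
  then show "l \<in> {\<lambda>i\<in>{..Suc 0}. if i = 0 then b else a}"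
    by auto
qed (use assms in \<open>auto simp: chains_def\<close>)

lemma chain_sum_0: "b < a \<Longrightarrow> chain_sum w 0 b a = w b a"
  by (simp add: chain_sum_def chains_0)

text \<open>The restriction keeps the lengthened chain extensional, hence a legitimate element of
  \<open>chains (Suc p) b a\<close>.\<close>

definition chain_cons :: "nat \<Rightarrow> nat \<Rightarrow> (nat \<Rightarrow> nat) \<Rightarrow> nat \<Rightarrow> nat" where
  "chain_cons p b l = (\<lambda>i\<in>{..Suc (Suc p)}. case i of 0 \<Rightarrow> b | Suc j \<Rightarrow> l j)"

lemma chain_cons_0 [simp]: "chain_cons p b l 0 = b"
  and chain_cons_Suc [simp]: "j \<le> Suc p \<Longrightarrow> chain_cons p b l (Suc j) = l j"
  by (simp_all add: chain_cons_def)

lemma chain_cons_in_chains: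
  assumes "b < n" "l \<in> chains p n a"
  shows "chain_cons p b l \<in> chains (Suc p) b a"
proof -
  have range: "l j \<in> {n..a}" if "j \<le> Suc p" for j
    using assms that by (auto simp: chains_def)
  have "chain_cons p b l i \<in> {b..a}" if "i \<le> Suc (Suc p)" for i
    using that range range[of 0] assms by (cases i) fastforce+
  moreover have "chain_cons p b l i < chain_cons p b l (Suc i)" if "i \<le> Suc p" for i
    using that assms by (cases i) (auto simp: chains_def)
  ultimately show ?thesis
    using assms by (auto simp: chains_def chain_cons_def)
qed

text \<open>Converse of \<open>chain_cons_in_chains\<close>: removing the first point undoes
  \<open>chain_cons\<close>. Together they give the bijection behind
  \<open>chain_sum_Suc\<close>.\<close>

lemma chain_tail:
  assumes "l \<in> chains (Suc p) b a"
  shows "(\<lambda>i\<in>{..Suc p}. l (Suc i)) \<in> chains p (l 1) a" "b < l 1" "l 1 < a"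
    and "chain_cons p b (\<lambda>i\<in>{..Suc p}. l (Suc i)) = l"
proof -
  have step: "l j < l (Suc j)" if "j \<le> Suc p" for j
    using assms that by (auto simp: chains_def)
  have ends: "l 0 = b" "l (Suc (Suc p)) = a"
    using assms by (auto simp: chains_def)
  have mono: "l i \<le> l j" if "i \<le> j" "j \<le> Suc (Suc p)" for i j
    using that
  proof (induction j rule: dec_induct)
    case (step k)
    then show ?case using \<open>\<And>j. j \<le> Suc p \<Longrightarrow> l j < l (Suc j)\<close>[of k] by simp
  qed simp
  show "b < l 1"
    using step[of 0] ends by simp
  show "l 1 < a"
    using mono[of 1 "Suc p"] step[of "Suc p"] ends by simp
  show "(\<lambda>i\<in>{..Suc p}. l (Suc i)) \<in> chains p (l 1) a"
    using step mono[of 1] mono[of _ "Suc (Suc p)"] ends by (auto simp: chains_def)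
  show "chain_cons p b (\<lambda>i\<in>{..Suc p}. l (Suc i)) = l"
  proof
    fix i
    show "chain_cons p b (\<lambda>i\<in>{..Suc p}. l (Suc i)) i = l i"
      using assms by (cases i) (auto simp: chain_cons_def chains_def PiE_def extensional_def)
  qed
qed

text \<open>Chains with at least two links are sorted by their second point \<open>n\<close>. The
  tail from \<open>n\<close> still has a link, hence \<open>n < a\<close>.\<close>

lemma chain_sum_Suc:
  "chain_sum w (Suc p) b a = (\<Sum>n\<in>{b<..<a}. w b n * chain_sum w p n a)"
proof -
  have prod_cons: "(\<Prod>j = 0..Suc p. w (chain_cons p b l j) (chain_cons p b l (j + 1))) =
      w b n * (\<Prod>j = 0..p. w (l j) (l (j + 1)))" if "l \<in> chains p n a" for l n
  proof -
    have "(\<Prod>j = 0..Suc p. w (chain_cons p b l j) (chain_cons p b l (j + 1))) =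
        w b (l 0) * (\<Prod>j = 0..p. w (chain_cons p b l (Suc j)) (chain_cons p b l (Suc (Suc j))))"
      unfolding prod.atLeast0_atMost_Suc_shift by (simp add: comp_def)
    also have "(\<Prod>j = 0..p. w (chain_cons p b l (Suc j)) (chain_cons p b l (Suc (Suc j)))) =
        (\<Prod>j = 0..p. w (l j) (l (j + 1)))"
      by (rule prod.cong) simp_all
    finally show ?thesis
      using that by (simp add: chains_def)
  qed
  have "(\<Sum>n\<in>{b<..<a}. w b n * chain_sum w p n a) =
      (\<Sum>(n, l)\<in>(SIGMA n:{b<..<a}. chains p n a). w b n * (\<Prod>j = 0..p. w (l j) (l (j + 1))))"
    by (simp add: chain_sum_def sum_distrib_left sum.Sigma finite_chains)
  also have "\<dots> = chain_sum w (Suc p) b a"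
    unfolding chain_sum_def
  proof (rule sum.reindex_bij_witness[where
        i = "\<lambda>l. (l 1, \<lambda>i\<in>{..Suc p}. l (Suc i))" and j = "\<lambda>(n, l). chain_cons p b l"])
    fix x assume "x \<in> (SIGMA n:{b<..<a}. chains p n a)"
    then obtain n l where x: "x = (n, l)" "b < n" "n < a" "l \<in> chains p n a"
      by auto
    have "(\<lambda>i\<in>{..Suc p}. chain_cons p b l (Suc i)) = l"
      using x by (auto simp: chains_def PiE_def extensional_def)
    then show "(((case x of (n, l) \<Rightarrow> chain_cons p b l) 1),
        \<lambda>i\<in>{..Suc p}. (case x of (n, l) \<Rightarrow> chain_cons p b l) (Suc i)) = x"
      using x by (simp add: chains_def)
    show "(case x of (n, l) \<Rightarrow> chain_cons p b l) \<in> chains (Suc p) b a"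
      using x by (simp add: chain_cons_in_chains)
    show "(\<Prod>j = 0..Suc p. w ((case x of (n, l) \<Rightarrow> chain_cons p b l) j)
          ((case x of (n, l) \<Rightarrow> chain_cons p b l) (j + 1))) =
        (case x of (n, l) \<Rightarrow> w b n * (\<Prod>j = 0..p. w (l j) (l (j + 1))))"
      using x prod_cons by simp
  qed (use chain_tail in auto)
  finally show ?thesis ..
qed

lemma chain_sum_eq_0: "b < a \<Longrightarrow> a - b \<le> p \<Longrightarrow> chain_sum w p b a = 0"
  by (induction p arbitrary: b) (auto simp: chain_sum_Suc intro!: sum.neutral)

text \<open>With W the strictly upper triangular part of \<open>w\<close>, these are the entries of
  the inverse of 1 + W, written as the Neumann series in -W, which is finite in each entry.\<close>

definition signed_chain_sum :: "(nat \<Rightarrow> nat \<Rightarrow> 'a::comm_ring_1) \<Rightarrow> nat \<Rightarrow> nat \<Rightarrow> 'a" where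
  "signed_chain_sum w b a =
     (if b > a then 0 else if b = a then 1 else
       (\<Sum>p = 0..a - b - 1. \<Sum>l \<in> chains p b a.
          (-1) ^ (p + 1) * (\<Prod>j = 0..p. w (l j) (l (j + 1)))))"

text \<open>Longer chains do not fit between \<open>b\<close> and \<open>a\<close>, so any cut-off
  \<open>N\<close> from \<open>a - b\<close> on is allowed, and one \<open>N\<close> can serve
  several starting points.\<close>

lemma signed_chain_sum_eq:
  assumes "b < a" "a - b \<le> N"
  shows "signed_chain_sum w b a = (\<Sum>p<N. (-1) ^ Suc p * chain_sum w p b a)"
proof -
  have "signed_chain_sum w b a = (\<Sum>p<a - b. (-1) ^ Suc p * chain_sum w p b a)"
  proof -
    have "{0..a - b - 1} = {..<a - b}"
      using assms by auto
    then show ?thesis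
      using assms unfolding signed_chain_sum_def chain_sum_def sum_distrib_left by simp
  qed
  also have "\<dots> = (\<Sum>p<N. (-1) ^ Suc p * chain_sum w p b a)"
    using assms by (intro sum.mono_neutral_left) (auto simp: chain_sum_eq_0)
  finally show ?thesis .
qed

text \<open>Off the diagonal, 1 + W times its Neumann inverse vanishes; splitting off the first link
  of each chain shows this.\<close>

lemma signed_chain_sum_rec:
  assumes "b < a"
  shows "(\<Sum>n\<in>{b<..a}. w b n * signed_chain_sum w n a) = - signed_chain_sum w b a"
proof -
  define N where "N = a - b"
  \<comment> \<open>Once the term \<open>p = 0\<close> is removed, \<open>N\<close> terms remain,
    enough for every start \<open>n > b\<close>.\<close>
  have "signed_chain_sum w b a = (\<Sum>p<Suc N. (-1) ^ Suc p * chain_sum w p b a)"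
    using assms by (intro signed_chain_sum_eq) (auto simp: N_def)
  also have "\<dots> = - w b a - (\<Sum>p<N. \<Sum>n\<in>{b<..<a}. w b n * ((-1) ^ Suc p * chain_sum w p n a))"
    using assms unfolding sum.lessThan_Suc_shift
    by (simp add: chain_sum_0 chain_sum_Suc sum_distrib_left sum_negf mult.left_commute)
  also have "(\<Sum>p<N. \<Sum>n\<in>{b<..<a}. w b n * ((-1) ^ Suc p * chain_sum w p n a)) =
      (\<Sum>n\<in>{b<..<a}. w b n * (\<Sum>p<N. (-1) ^ Suc p * chain_sum w p n a))"
    unfolding sum_distrib_left by (rule sum.swap)
  also have "\<dots> = (\<Sum>n\<in>{b<..<a}. w b n * signed_chain_sum w n a)"
    by (intro sum.cong refl arg_cong2[where f = "(*)"] signed_chain_sum_eq[symmetric])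
      (auto simp: N_def)
  \<comment> \<open>The term \<open>p = 0\<close> becomes the summand \<open>n = a\<close>, where
    the signed sum is 1.\<close>
  also have "- w b a - \<dots> = - (\<Sum>n\<in>insert a {b<..<a}. w b n * signed_chain_sum w n a)"
    by (simp add: signed_chain_sum_def)
  also have "insert a {b<..<a} = {b<..a}"
    using assms by auto
  finally show ?thesis
    by simp
qed

section \<open>Multinomial expansion and the matrix $T'$\<close>

lemma finite_tuples_with_sum:
  assumes "finite S"
  shows "finite {k \<in> S \<rightarrow>\<^sub>E UNIV. sum k S = (a :: nat)}"
proof (rule finite_subset)
  show "{k \<in> S \<rightarrow>\<^sub>E UNIV. sum k S = a} \<subseteq> S \<rightarrow>\<^sub>E {..a}"
  proof
    fix k assume k: "k \<in> {k \<in> S \<rightarrow>\<^sub>E UNIV. sum k S = a}"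
    then have "k t \<le> a" if "t \<in> S" for t
      using member_le_sum[of t S k] assms that by simp
    with k show "k \<in> S \<rightarrow>\<^sub>E {..a}"
      by (simp add: PiE_iff)
  qed
qed (use assms in \<open>simp add: finite_PiE\<close>)

text \<open>The multinomial theorem in divided powers \<open>x ^ k / fact k\<close>. In this form
  adding an index to \<open>S\<close> is a plain convolution, so the binomial theorem closes the
  induction.\<close>

lemma multinomial_divided_power:
  fixes x :: "'i \<Rightarrow> 'a::field_char_0"
  assumes "finite S"
  shows "(\<Sum>k \<in> {k \<in> S \<rightarrow>\<^sub>E UNIV. sum k S = a}. \<Prod>t\<in>S. x t ^ k t / fact (k t)) =
    sum x S ^ a / fact a"
  using assms
proof (induction S arbitrary: a rule: finite_induct)
  case empty
  have "{k \<in> {} \<rightarrow>\<^sub>E (UNIV :: nat set). sum k {} = a} = (if a = 0 then {\<lambda>_. undefined} else {})"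
    by (auto simp: extensional_def)
  then show ?case
    by (simp add: power_0_left)
next
  case (insert s S)
  define E where "E = (\<lambda>(A :: 'i set) a. {k \<in> A \<rightarrow>\<^sub>E (UNIV :: nat set). sum k A = a})"
  have fin: "finite (E S a)" for a
    using insert.hyps by (simp add: E_def finite_tuples_with_sum)
  \<comment> \<open>A tuple is split into its value at \<open>s\<close> and the rest, which is reset
    to \<open>undefined\<close> at \<open>s\<close> to be extensional on \<open>S\<close>.\<close>
  have "(\<Sum>k \<in> E (insert s S) a. \<Prod>t\<in>insert s S. x t ^ k t / fact (k t)) =
      (\<Sum>(j, k) \<in> (SIGMA j:{..a}. E S (a - j)).
        x s ^ j / fact j * (\<Prod>t\<in>S. x t ^ k t / fact (k t)))"
  proof (rule sum.reindex_bij_witness[where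
        i = "\<lambda>(j, k). k(s := j)" and j = "\<lambda>k. (k s, k(s := undefined))"], goal_cases)
    case (2 k)
    moreover have "(\<Sum>t\<in>S. if t = s then undefined else k t) = sum k S"
      using insert.hyps by (intro sum.cong) auto
    ultimately show ?case
      using insert.hyps by (auto simp: E_def PiE_def extensional_def)
  next
    case (3 y)
    then show ?case
      using insert.hyps by (fastforce simp: E_def PiE_def extensional_def fun_eq_iff)
  next
    case (4 y)
    obtain j k where y: "y = (j, k)"
      by (cases y)
    have "(\<Sum>t\<in>S. if t = s then j else k t) = sum k S"
      using insert.hyps by (intro sum.cong) auto
    with 4 y show ?case
      using insert.hyps by (auto simp: E_def PiE_def extensional_def)
  next
    case (5 k)
    have "(\<Prod>t\<in>S. x t ^ (k(s := undefined)) t / fact ((k(s := undefined)) t)) =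
        (\<Prod>t\<in>S. x t ^ k t / fact (k t))"
      using insert.hyps by (intro prod.cong) auto
    then show ?case
      using insert.hyps by simp
  qed (auto simp: fun_eq_iff)
  also have "\<dots> = (\<Sum>j\<le>a. x s ^ j / fact j * (\<Sum>k \<in> E S (a - j). \<Prod>t\<in>S. x t ^ k t / fact (k t)))"
    by (simp add: sum.Sigma fin sum_distrib_left)
  also have "\<dots> = (\<Sum>j\<le>a. x s ^ j / fact j * (sum x S ^ (a - j) / fact (a - j)))"
    using insert.IH by (simp add: E_def)
  also have "\<dots> = (x s + sum x S) ^ a / fact a"
    unfolding binomial_ring sum_divide_distrib
    by (intro sum.cong) (simp_all add: binomial_fact field_simps)
  finally show ?case
    using insert.hyps by (simp add: E_def)
qed

lemma transfer_entry_eq_0_above: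
  assumes "m * a < b"
  shows "transfer_entry m c d a b = 0"
proof -
  have "(\<Sum>l\<le>m. l * k l) \<le> m * (\<Sum>l\<le>m. k l)" for k :: "nat \<Rightarrow> nat"
    unfolding sum_distrib_left by (intro sum_mono) simp
  with assms have "exponent_tuples m a b = {}"
    by (auto simp: exponent_tuples_def not_le[symmetric])
  then show ?thesis
    by (simp add: transfer_entry_def)
qed

text \<open>The multinomial terms of the power are grouped by their degree in \<open>z\<close>. This
  identifies $T'$ as the Carleman matrix of the shifted polynomial.\<close>

lemma transfer_entry_sums_power:
  "(\<Sum>b\<le>m * a. transfer_entry m c d a b * z ^ b) = (\<Sum>t\<le>m. shifted_coeff m c d t * z ^ t) ^ a"
proof -
  define E where "E = {k \<in> {..m} \<rightarrow>\<^sub>E (UNIV :: nat set). (\<Sum>l\<le>m. k l) = a}"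
  define g where "g k = (\<Prod>t\<le>m. (shifted_coeff m c d t * z ^ t) ^ k t / fact (k t))" for k
  have fin: "finite E"
    unfolding E_def by (rule finite_tuples_with_sum) simp
  have weight: "(\<lambda>k. \<Sum>l\<le>m. l * k l) ` E \<subseteq> {..m * a}"
  proof
    fix b assume "b \<in> (\<lambda>k. \<Sum>l\<le>m. l * k l) ` E"
    then obtain k where "k \<in> E" "b = (\<Sum>l\<le>m. l * k l)"
      by blast
    moreover have "(\<Sum>l\<le>m. l * k l) \<le> m * (\<Sum>l\<le>m. k l)"
      unfolding sum_distrib_left by (intro sum_mono) simp
    ultimately show "b \<in> {..m * a}"
      by (simp add: E_def)
  qed
  have summand: "fact a / (\<Prod>s\<le>m. fact (k s)) * (\<Prod>t\<le>m. shifted_coeff m c d t ^ k t) * z ^ b =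
      fact a * g k" if "k \<in> exponent_tuples m a b" for k b
  proof -
    have "z ^ b = (\<Prod>t\<le>m. (z ^ t) ^ k t)"
      using that by (auto simp: exponent_tuples_def power_mult[symmetric] power_sum[symmetric])
    then show ?thesis
      by (simp add: g_def power_mult_distrib prod.distrib prod_dividef)
  qed
  have "(\<Sum>b\<le>m * a. transfer_entry m c d a b * z ^ b) =
      (\<Sum>b\<le>m * a. \<Sum>k \<in> exponent_tuples m a b. fact a * g k)"
    unfolding transfer_entry_def sum_distrib_right by (intro sum.cong refl summand)
  also have "\<dots> = (\<Sum>b\<le>m * a. \<Sum>k \<in> {k \<in> E. (\<Sum>l\<le>m. l * k l) = b}. fact a * g k)"
    by (intro sum.cong) (auto simp: exponent_tuples_def E_def)
  also have "\<dots> = (\<Sum>k \<in> E. fact a * g k)"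
    using fin weight by (intro sum.group) auto
  also have "\<dots> = (\<Sum>t\<le>m. shifted_coeff m c d t * z ^ t) ^ a"
    using multinomial_divided_power[of "{..m}" "\<lambda>t. shifted_coeff m c d t * z ^ t" a]
    by (simp add: E_def g_def sum_distrib_left[symmetric])
  finally show ?thesis .
qed

text \<open>
  A tuple contributes to $T'_{ab}$ only if \<open>k 0 = 0\<close>, because $c'_0 = 0$; then
  \<open>b - a = (\<Sum>l\<ge>1. (l - 1) * k l)\<close>.
\<close>

lemma exponent_tuple_deficit:
  assumes "k \<in> exponent_tuples m a b" "k 0 = 0"
  shows "b = a + (\<Sum>l\<le>m. (l - 1) * k l)"
proof -
  have "a + (\<Sum>l\<le>m. (l - 1) * k l) = (\<Sum>l\<le>m. k l + (l - 1) * k l)"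
    using assms by (simp add: exponent_tuples_def sum.distrib)
  also have "\<dots> = (\<Sum>l\<le>m. l * k l)"
  proof (rule sum.cong)
    fix l show "k l + (l - 1) * k l = l * k l"
      using assms by (cases l) simp_all
  qed simp
  finally show ?thesis
    using assms by (simp add: exponent_tuples_def)
qed

lemma transfer_term_eq_0:
  assumes "k 0 \<noteq> 0"
  shows "(\<Prod>t\<le>m. shifted_coeff m c d t ^ k t) = 0"
  using assms by (intro prod_zero bexI[of _ 0]) (auto simp: shifted_coeff_def)

lemma transfer_entry_eq_0_below:
  assumes "b < a"
  shows "transfer_entry m c d a b = 0"
  unfolding transfer_entry_def
proof (rule sum.neutral, rule ballI)
  fix k assume "k \<in> exponent_tuples m a b"
  with assms have "k 0 \<noteq> 0"
    using exponent_tuple_deficit[of k m a b] by linarith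
  then show "fact a / (\<Prod>s\<le>m. fact (k s)) * (\<Prod>t\<le>m. shifted_coeff m c d t ^ k t) = 0"
    by (simp add: transfer_term_eq_0)
qed

text \<open>For \<open>b = a\<close> the deficit is zero, which forces all of the weight onto index
  1; that single tuple \<open>k1\<close> has multinomial coefficient 1.\<close>

lemma transfer_entry_diag:
  assumes "m \<ge> 1"
  shows "transfer_entry m c d a a = shifted_coeff m c d 1 ^ a"
proof -
  define k1 where "k1 = (\<lambda>l\<in>{..m}. if l = 1 then a else 0)"
  define g where "g k = fact a / (\<Prod>s\<le>m. fact (k s)) * (\<Prod>t\<le>m. shifted_coeff m c d t ^ k t)" for k
  have k1: "k1 \<in> exponent_tuples m a a"
  proof -
    have "(\<Sum>l\<le>m. k1 l) = (\<Sum>l\<in>{1}. k1 l)" "(\<Sum>l\<le>m. l * k1 l) = (\<Sum>l\<in>{1}. l * k1 l)"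
      using assms by (intro sum.mono_neutral_right; auto simp: k1_def)+
    then show ?thesis
      using assms by (simp add: exponent_tuples_def k1_def)
  qed
  have unique: "k = k1" if k: "k \<in> exponent_tuples m a a" and "k 0 = 0" for k
  proof -
    have "(\<Sum>l\<le>m. (l - 1) * k l) = 0"
      using exponent_tuple_deficit[OF that] by simp
    then have zero: "k l = 0" if "l \<le> m" "l \<noteq> 1" for l
    proof (cases "l = 0")
      case False
      have "(l - 1) * k l = 0"
        using \<open>(\<Sum>l\<le>m. (l - 1) * k l) = 0\<close> that by simp
      with False that show ?thesis
        by simp
    qed (use \<open>k 0 = 0\<close> in simp)
    have "a = (\<Sum>l\<le>m. k l)"
      using k by (simp add: exponent_tuples_def)
    also have "\<dots> = (\<Sum>l\<in>{1}. k l)"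
      using assms zero by (intro sum.mono_neutral_right) auto
    finally have "k 1 = a"
      by simp
    then show ?thesis
      using k zero by (auto simp: k1_def exponent_tuples_def PiE_def extensional_def fun_eq_iff)
  qed
  have "transfer_entry m c d a a = (\<Sum>k \<in> {k1}. g k)"
    unfolding transfer_entry_def g_def[symmetric]
  proof (rule sum.mono_neutral_right)
    show "\<forall>k \<in> exponent_tuples m a a - {k1}. g k = 0"
    proof
      fix k assume "k \<in> exponent_tuples m a a - {k1}"
      then have "k 0 \<noteq> 0"
        using unique by blast
      then show "g k = 0"
        by (simp add: g_def transfer_term_eq_0)
    qed
  qed (use k1 finite_exponent_tuples in auto)
  moreover have "(\<Prod>s\<le>m. fact (k1 s)) = (\<Prod>s\<in>{1}. fact (k1 s) :: complex)"
    using assms by (intro prod.mono_neutral_right) (auto simp: k1_def)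
  moreover have "(\<Prod>t\<le>m. shifted_coeff m c d t ^ k1 t) =
      (\<Prod>t\<in>{1}. shifted_coeff m c d t ^ k1 t)"
    using assms by (intro prod.mono_neutral_right) (auto simp: k1_def)
  ultimately show ?thesis
    using assms by (simp add: g_def k1_def)
qed

section \<open>Diagonalisation\<close>

text \<open>The weight involves the eigenvalue with index \<open>a\<close>, so each column has its
  own weight. Its zero denominator at \<open>i = a\<close> is never met, since links start below
  \<open>a\<close>.\<close>

lemma eigvec_entry_eq_signed_chain_sum:
  "eigvec_entry m c d b a = signed_chain_sum
     (\<lambda>i j. transfer_entry m c d i j / (transfer_entry m c d i i - transfer_entry m c d a a)) b a"
  by (simp add: eigvec_entry_def signed_chain_sum_def)

lemma inv_eigvec_entry_eq_signed_chain_sum: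
  "inv_eigvec_entry m c d b a = signed_chain_sum (eigvec_entry m c d) b a"
proof -
  have "eigvec_entry m c d i i = 1" for i
    by (simp add: eigvec_entry_def)
  then show ?thesis
    by (simp add: inv_eigvec_entry_def signed_chain_sum_def)
qed

text \<open>This is the chain recursion multiplied by the eigenvalue gap \<open>t\<close>. The range
  \<open>b..a\<close> is the whole row, because $T'$ is upper triangular and $v'_a$ vanishes beyond
  \<open>a\<close>.\<close>

lemma eigvec_equation:
  assumes distinct: "b < a \<Longrightarrow> transfer_entry m c d b b \<noteq> transfer_entry m c d a a"
    and "b \<le> a"
  shows "(\<Sum>n = b..a. transfer_entry m c d b n * eigvec_entry m c d n a) =
    transfer_entry m c d a a * eigvec_entry m c d b a"
proof (cases "b = a")
  case False
  with \<open>b \<le> a\<close> have "b < a"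
    by simp
  define t where "t = transfer_entry m c d b b - transfer_entry m c d a a"
  define w where "w i j = transfer_entry m c d i j /
    (transfer_entry m c d i i - transfer_entry m c d a a)" for i j
  have eigvec: "eigvec_entry m c d n a = signed_chain_sum w n a" for n
    by (simp add: eigvec_entry_eq_signed_chain_sum w_def[abs_def])
  have "t \<noteq> 0"
    using distinct \<open>b < a\<close> by (simp add: t_def)
  then have "(\<Sum>n\<in>{b<..a}. transfer_entry m c d b n * eigvec_entry m c d n a) =
      t * (\<Sum>n\<in>{b<..a}. w b n * signed_chain_sum w n a)"
    by (simp add: sum_distrib_left eigvec) (simp add: w_def t_def)
  also have "\<dots> = - t * eigvec_entry m c d b a"
    using \<open>b < a\<close> by (simp add: signed_chain_sum_rec eigvec)
  finally show ?thesis
    using \<open>b < a\<close> by (simp add: sum.head t_def algebra_simps)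
qed simp

text \<open>The eigenvector matrix has unit diagonal, so it is 1 + W for the weight
  \<open>eigvec_entry m c d\<close>, and the signed chain sums invert it.\<close>

lemma inv_eigvec_inverse:
  assumes "b \<le> a"
  shows "(\<Sum>n = b..a. eigvec_entry m c d b n * inv_eigvec_entry m c d n a) = (if b = a then 1 else 0)"
proof (cases "b = a")
  case True
  then show ?thesis
    by (simp add: eigvec_entry_def inv_eigvec_entry_def)
next
  case False
  with assms have "b < a"
    by simp
  then show ?thesis
    using signed_chain_sum_rec[of b a "eigvec_entry m c d"]
    by (simp add: sum.head inv_eigvec_entry_eq_signed_chain_sum eigvec_entry_def[of m c d b b])
qed

text \<open>Both eigenvector matrices are upper triangular, so the product defining this entry is a
  finite sum over \<open>a..b\<close> and raises no question of convergence.\<close>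

definition iterate_entry ::
    "nat \<Rightarrow> (nat \<Rightarrow> complex) \<Rightarrow> complex \<Rightarrow> nat \<Rightarrow> nat \<Rightarrow> nat \<Rightarrow> complex" where
  "iterate_entry m c d i a b =
     (\<Sum>j = a..b. eigvec_entry m c d a j * transfer_entry m c d j j ^ i * inv_eigvec_entry m c d j b)"

lemma iterate_entry_0: "iterate_entry m c d 0 a b = (if a = b then 1 else 0)"
  by (cases "a \<le> b") (auto simp: iterate_entry_def inv_eigvec_inverse)

text \<open>One eigenvalue factor is absorbed by the eigenvector equation. The bound
  \<open>m * a\<close> is independent of \<open>b\<close>, so the identity can be summed over
  \<open>b\<close> termwise.\<close>

lemma iterate_entry_Suc:
  assumes distinct: "\<And>i j. i < j \<Longrightarrow> transfer_entry m c d i i \<noteq> transfer_entry m c d j j"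
  shows "iterate_entry m c d (Suc i) a b =
    (\<Sum>n\<le>m * a. transfer_entry m c d a n * iterate_entry m c d i n b)"
proof -
  define T where "T = transfer_entry m c d"
  define V where "V = eigvec_entry m c d"
  define Q where "Q = inv_eigvec_entry m c d"
  have "iterate_entry m c d (Suc i) a b = (\<Sum>j = a..b. T j j * V a j * (T j j ^ i * Q j b))"
    by (simp add: iterate_entry_def T_def V_def Q_def mult_ac)
  also have "\<dots> = (\<Sum>j = a..b. (\<Sum>n = a..j. T a n * V n j) * (T j j ^ i * Q j b))"
    unfolding T_def V_def by (intro sum.cong refl) (simp add: eigvec_equation distinct)
  also have "\<dots> = (\<Sum>j = a..b. \<Sum>n\<in>{n \<in> {a..b}. n \<le> j}. T a n * (V n j * T j j ^ i * Q j b))"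
    unfolding sum_distrib_right by (intro sum.cong) (auto simp: mult_ac)
  also have "\<dots> = (\<Sum>n = a..b. \<Sum>j\<in>{j \<in> {a..b}. n \<le> j}. T a n * (V n j * T j j ^ i * Q j b))"
    by (rule sum.swap_restrict) simp_all
  also have "\<dots> = (\<Sum>n = a..b. T a n * iterate_entry m c d i n b)"
    unfolding iterate_entry_def sum_distrib_left T_def V_def Q_def
    by (intro sum.cong) auto
  \<comment> \<open>Added indices contribute nothing: below \<open>a\<close> by triangularity of
    $T'$, above \<open>b\<close> because \<open>iterate_entry\<close> is an empty sum.\<close>
  also have "\<dots> = (\<Sum>n\<in>{a..b} \<union> {..m * a}. T a n * iterate_entry m c d i n b)"
    by (intro sum.mono_neutral_left)
      (auto simp: T_def transfer_entry_eq_0_below iterate_entry_def not_le)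
  also have "\<dots> = (\<Sum>n\<le>m * a. T a n * iterate_entry m c d i n b)"
    by (intro sum.mono_neutral_right) (auto simp: T_def transfer_entry_eq_0_above)
  finally show ?thesis
    by (simp add: T_def)
qed

text \<open>Each row for \<open>Suc i\<close> is a finite combination of rows for \<open>i\<close>,
  so convergence at every \<open>z\<close> passes through the induction without estimates.\<close>

lemma iterate_entry_sums:
  assumes distinct: "\<And>i j. i < j \<Longrightarrow> transfer_entry m c d i i \<noteq> transfer_entry m c d j j"
  shows "(\<lambda>b. iterate_entry m c d i a b * z ^ b) sums
    ((\<lambda>x. \<Sum>t\<le>m. shifted_coeff m c d t * x ^ t) ^^ i) z ^ a"
proof (induction i arbitrary: a)
  case 0
  have "(\<lambda>b. iterate_entry m c d 0 a b * z ^ b) = (\<lambda>b. if b = a then z ^ b else 0)"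
    by (auto simp: iterate_entry_0)
  then show ?case
    using sums_single[of a "\<lambda>b. z ^ b"] by simp
next
  case (Suc i)
  let ?G = "\<lambda>x. \<Sum>t\<le>m. shifted_coeff m c d t * x ^ t"
  have "(\<lambda>b. \<Sum>n\<le>m * a. transfer_entry m c d a n * (iterate_entry m c d i n b * z ^ b)) sums
      (\<Sum>n\<le>m * a. transfer_entry m c d a n * (?G ^^ i) z ^ n)"
    by (intro sums_sum sums_mult Suc.IH)
  also have "(\<Sum>n\<le>m * a. transfer_entry m c d a n * (?G ^^ i) z ^ n) = (?G ^^ Suc i) z ^ a"
    by (simp add: transfer_entry_sums_power)
  finally show ?case
    by (simp add: iterate_entry_Suc[OF distinct] sum_distrib_right mult.assoc)
qed

section \<open>The recurrence\<close>

text \<open>Taylor expansion about the fixed point \<open>d\<close>. The true constant term is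
  \<open>d\<close>, while \<open>shifted_coeff\<close> is 0 there; this accounts for the
  subtraction.\<close>

lemma sum_shifted_coeff:
  assumes "(\<Sum>j\<le>m. c j * d ^ j) = d"
  shows "(\<Sum>t\<le>m. shifted_coeff m c d t * z ^ t) = (\<Sum>j\<le>m. c j * (d + z) ^ j) - d"
proof -
  define f where "f t j = c j * of_nat (j choose t) * d ^ (j - t) * z ^ t" for t j
  have "(\<Sum>j\<le>m. c j * (d + z) ^ j) = (\<Sum>j\<le>m. \<Sum>t\<in>{t \<in> {..m}. t \<le> j}. f t j)"
  proof (intro sum.cong refl)
    fix j assume "j \<in> {..m}"
    then have "{t \<in> {..m}. t \<le> j} = {..j}"
      by auto
    then show "c j * (d + z) ^ j = (\<Sum>t\<in>{t \<in> {..m}. t \<le> j}. f t j)"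
      by (simp add: add.commute[of d] binomial_ring f_def sum_distrib_left mult_ac)
  qed
  also have "\<dots> = (\<Sum>t\<le>m. \<Sum>j\<in>{j \<in> {..m}. t \<le> j}. f t j)"
    by (rule sum.swap_restrict) simp_all
  also have "\<dots> = (\<Sum>t\<le>m. \<Sum>j = t..m. f t j)"
    by (intro sum.cong) auto
  also have "\<dots> = (\<Sum>t\<le>m. shifted_coeff m c d t * z ^ t + (if t = 0 then d else 0))"
  proof (intro sum.cong refl)
    fix t
    show "(\<Sum>j = t..m. f t j) = shifted_coeff m c d t * z ^ t + (if t = 0 then d else 0)"
      using assms by (cases "t = 0")
        (auto simp: f_def shifted_coeff_def sum_distrib_right atLeast0AtMost)
  qed
  finally show ?thesis
    by (simp add: sum.distrib)
qed

text \<open>Links the hypothesis on modulus and argument to the eigenvalues: it excludes roots of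
  unity as multipliers.\<close>

lemma root_of_unity_arg_turns:
  assumes "z ^ n = 1" "n > 0"
  shows "cmod z = 1" "arg_turns z \<in> \<rat>"
proof -
  show norm: "cmod z = 1"
    using assms by (metis power_eq_1_iff less_not_refl)
  then have "z = cis (Arg z)"
    using rcis_cmod_Arg[of z] by (simp add: rcis_def)
  then have "cis (real n * Arg z) = 1"
    using assms by (metis Complex.DeMoivre)
  then have "cos (real n * Arg z) = 1"
    by (simp add: complex_eq_iff)
  then obtain k :: int where "real n * Arg z = of_int k * 2 * pi"
    by (auto simp: cos_one_2pi_int)
  then have "arg_turns z = of_int k / of_nat n"
    using assms by (simp add: arg_turns_def field_simps)
  then show "arg_turns z \<in> \<rat>"
    by simp
qed

text \<open>Summability is asserted with the value, since \<open>suminf\<close> of a divergent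
  series would carry no information.\<close>

theorem theorem2p6:
  fixes m :: nat and c :: "nat \<Rightarrow> complex" and u :: "nat \<Rightarrow> complex" and d :: complex
  assumes recurrence: "\<And>i. i \<ge> 1 \<Longrightarrow> u i = (\<Sum>j = 0..m. c j * u (i - 1) ^ j)"
    and root: "(\<Sum>j = 0..m. c j * d ^ j) = d"
    and nonzero: "cmod (\<Sum>j = 1..m. of_nat j * c j * d ^ (j - 1)) \<noteq> 0"
    and nonresonant: "cmod (\<Sum>j = 1..m. of_nat j * c j * d ^ (j - 1)) \<noteq> 1 \<or>
           arg_turns (\<Sum>j = 1..m. of_nat j * c j * d ^ (j - 1)) \<notin> \<rat>"
  shows "\<forall>i. summable (\<lambda>n. let l = n + 1 in
               \<Sum>j = 1..l. eigvec_entry m c d 1 j * shifted_coeff m c d 1 ^ (i * j)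
                 * inv_eigvec_entry m c d j l * (u 0 - d) ^ l) \<and>
             u i = d + (\<Sum>n. let l = n + 1 in
               \<Sum>j = 1..l. eigvec_entry m c d 1 j * shifted_coeff m c d 1 ^ (i * j)
                 * inv_eigvec_entry m c d j l * (u 0 - d) ^ l)"
proof
  fix i
  let ?r = "shifted_coeff m c d 1"
  let ?G = "\<lambda>x. \<Sum>t\<le>m. shifted_coeff m c d t * x ^ t"
  define h where "h = (\<lambda>b. iterate_entry m c d i 1 b * (u 0 - d) ^ b)"
  have m: "m \<ge> 1"
    using nonzero by (cases m) auto
  have multiplier: "(\<Sum>j = 1..m. of_nat j * c j * d ^ (j - 1)) = ?r"
    by (simp add: shifted_coeff_def mult_ac)
  have diag: "transfer_entry m c d j j = ?r ^ j" for j
    using m by (rule transfer_entry_diag)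
  \<comment> \<open>Two equal powers of the nonzero multiplier would make it a root of unity of
    order dividing \<open>k - j\<close>.\<close>
  have distinct: "transfer_entry m c d j j \<noteq> transfer_entry m c d k k" if "j < k" for j k
  proof
    assume "transfer_entry m c d j j = transfer_entry m c d k k"
    then have "?r ^ k = ?r ^ j"
      by (simp only: diag)
    moreover have "?r ^ k = ?r ^ j * ?r ^ (k - j)"
      using that by (simp flip: power_add)
    ultimately have "?r ^ j * ?r ^ (k - j) = ?r ^ j * 1"
      by simp
    then have "?r ^ (k - j) = 1"
      using nonzero unfolding multiplier by simp
    then show False
      using root_of_unity_arg_turns[of ?r "k - j"] that nonresonant unfolding multiplier by simp
  qed
  have iterate: "(?G ^^ i) (u 0 - d) = u i - d"
  proof (induction i)
    case (Suc i)
    then show ?case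
      using root recurrence[of "Suc i"] by (simp add: sum_shifted_coeff atLeast0AtMost)
  qed simp
  have "h sums (u i - d)"
    using iterate_entry_sums[OF distinct, where i = i and a = 1 and z = "u 0 - d"] iterate
    by (simp add: h_def)
  \<comment> \<open>The sum over \<open>1..0\<close> is empty, so the series may start at
    \<open>l = 1\<close>, matching the shift \<open>l = n + 1\<close>.\<close>
  moreover have "h 0 = 0"
    by (simp add: h_def iterate_entry_def)
  ultimately have "(\<lambda>n. h (Suc n)) sums (u i - d)"
    by (simp add: sums_Suc_iff)
  moreover have "(\<lambda>n. h (Suc n)) = (\<lambda>n. let l = n + 1 in
      \<Sum>j = 1..l. eigvec_entry m c d 1 j * ?r ^ (i * j) * inv_eigvec_entry m c d j l * (u 0 - d) ^ l)"
    by (simp add: h_def iterate_entry_def diag sum_distrib_right mult.commute[of i] power_mult)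
  ultimately show "summable (\<lambda>n. let l = n + 1 in
      \<Sum>j = 1..l. eigvec_entry m c d 1 j * ?r ^ (i * j) * inv_eigvec_entry m c d j l * (u 0 - d) ^ l) \<and>
    u i = d + (\<Sum>n. let l = n + 1 in
      \<Sum>j = 1..l. eigvec_entry m c d 1 j * ?r ^ (i * j) * inv_eigvec_entry m c d j l * (u 0 - d) ^ l)"
    by (simp add: sums_iff)
qed

end
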